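(* Let $A$ and $B$ be finite non-collinear sets in $\mathbb{R}^2$ with $i_A=i_B=1$. Then $$\sqrt{2i_{A+B}+b_{A+B}-2}\geq \sqrt{2i_A+b_A-2}+\sqrt{2i_B+b_B-2},$$ equivalently $\mathrm{tr}(A+B)^{1/2}\geq \mathrm{tr}(A)^{1/2}+\mathrm{tr}(B)^{1/2}$.
   Context: $A+B=\{a+b:a\in A,\ b\in B\}$; $[X]$ is the convex hull of $X$. For a finite non-collinear set $C\subset\mathbb{R}^2$, $b_C$ and $i_C$ denote the number of points of $C$ on the boundary $\partial[C]$ and in the interior of $[C]$, respectively, and $\mathrm{tr}(C)$ denotes the common number of triangles in any triangulation of $[C]$ using the points of $C$ as vertices; one has $\mathrm{tr}(C)=b_C+2i_C-2$. *)

theory Defs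
  imports "HOL-Analysis.Analysis"
begin

definition bd_pts :: "(real^2) set \<Rightarrow> nat" where
  "bd_pts C = card (C \<inter> frontier (convex hull C))"

definition int_pts :: "(real^2) set \<Rightarrow> nat" where
  "int_pts C = card (C \<inter> interior (convex hull C))"

(* Every point of C has to occur as a vertex; otherwise the number of triangles
   would depend on the triangulation. *)
definition triangulates :: "(real^2) set set \<Rightarrow> (real^2) set \<Rightarrow> bool" where
  "triangulates \<T> C \<longleftrightarrow>
     triangulation \<T> \<and> (\<forall>T\<in>\<T>. 2 simplex T) \<and> \<Union>\<T> = convex hull C \<and>
     (\<Union>T\<in>\<T>. {x. x extreme_point_of T}) = C"

end

theory Submission
  imports Defs
begin

text \<open>
  Write \<open>m\<close> and \<open>n\<close> for the numbers of boundary points of \<open>A\<close> and \<open>B\<close>. Translating \<open>A\<close> by the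
  interior point of \<open>B\<close> shows that \<open>A + B\<close> has at least \<open>m + 1\<close> interior points, and likewise at least
  \<open>n + 1\<close>. Adding up the boundary edge by edge, with the edges indexed by their direction, shows that
  \<open>A + B\<close> has at least \<open>m + n\<close> boundary points. So \<open>tr(A + B) \<ge> 2(m + n) \<ge> (\<surd>m + \<surd>n)\<^sup>2\<close>.

  To count the triangles of a triangulation, choose a direction in which no two points of \<open>C\<close> have
  the same height and charge each triangle to its vertex of middle height. The horizontal line through
  an interior point enters two triangles there, the one through a boundary point enters one, except
  at the highest and the lowest point, where it enters none. Hence \<open>tr(C) = 2i + b - 2\<close>.
\<close>

section \<open>Quarter turns and linear functionals on the plane\<close>

text \<open>The counterclockwise quarter turn. Thus \<open>rot d \<bullet> z\<close> is the
  determinant of \<open>d\<close> and \<open>z\<close>, positive when \<open>z\<close> points to the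
  left of \<open>d\<close>; it serves as the height of \<open>z\<close> above the line of direction
  \<open>d\<close>.\<close>

definition rot :: "real^2 \<Rightarrow> real^2" where
  "rot d = vector [- (d$2), d$1]"

lemma inner_rot: "rot d \<bullet> z = d$1 * z$2 - d$2 * z$1"
  by (simp add: rot_def inner_vec_def sum_2)

lemma rot_eq_0_iff [simp]: "rot d = 0 \<longleftrightarrow> d = 0"
  by (auto simp: rot_def vec_eq_iff forall_2)

lemma inner_rot_self [simp]: "rot d \<bullet> d = 0"
  by (simp add: inner_rot)

lemma inner_rot_commute: "rot d \<bullet> e = - (rot e \<bullet> d)"
  by (simp add: inner_rot)

lemma inner_rot_scaleR: "rot (c *\<^sub>R d) \<bullet> e = c * (rot d \<bullet> e)"
  by (simp add: inner_rot algebra_simps)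

lemma rot_rot: "rot (rot d) = - d"
  by (simp add: rot_def vec_eq_iff forall_2)

lemma rot_uminus: "rot (- d) = - rot d"
  by (simp add: rot_def vec_eq_iff forall_2)

text \<open>The determinant of \<open>v\<close> and \<open>w\<close>, computed from their
  coordinates in the orthogonal basis \<open>e\<close>, \<open>rot e\<close>.\<close>

lemma inner_rot_lagrange:
  "(e \<bullet> e) * (rot v \<bullet> w) = (e \<bullet> v) * (rot e \<bullet> w) - (rot e \<bullet> v) * (e \<bullet> w)"
  unfolding inner_rot by (simp add: inner_vec_def sum_2 algebra_simps)

lemma rot_parallel:
  assumes "d \<noteq> 0" "rot d \<bullet> e = 0"
  shows "\<exists>t. e = t *\<^sub>R d"
proof
  have "(d \<bullet> d) *\<^sub>R e = (d \<bullet> e) *\<^sub>R d"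
    using assms(2) unfolding inner_rot by (simp add: vec_eq_iff forall_2 inner_vec_def sum_2 algebra_simps)
  then show "e = ((d \<bullet> e) / (d \<bullet> d)) *\<^sub>R d"
    using assms(1) by (metis divide_inverse_commute inner_eq_zero_iff scaleR_scaleR scaleR_one left_inverse)
qed

lemma not_in_line:
  fixes C :: "(real^2) set"
  assumes "interior (convex hull C) \<noteq> {}" "d \<noteq> 0"
  shows "\<exists>z\<in>C. rot d \<bullet> z \<noteq> c"
proof (rule ccontr)
  assume "\<not> ?thesis"
  then have "convex hull C \<subseteq> {z. rot d \<bullet> z = c}"
    by (intro hull_minimal) (auto simp: convex_hyperplane)
  then have "interior (convex hull C) \<subseteq> interior {z. rot d \<bullet> z = c}"
    by (rule interior_mono)
  then show False
    using assms by simp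
qed

lemma inner_convex_hull_ge:
  assumes "\<And>z. z \<in> C \<Longrightarrow> c \<le> a \<bullet> z" "w \<in> convex hull C"
  shows "c \<le> a \<bullet> w"
proof -
  have "convex hull C \<subseteq> {z. a \<bullet> z \<ge> c}"
    using assms by (intro hull_minimal) (auto simp: convex_halfspace_ge)
  then show ?thesis
    using assms by auto
qed

lemma minimum_not_interior:
  fixes a :: "'a::euclidean_space"
  assumes "a \<noteq> 0" "\<And>z. z \<in> S \<Longrightarrow> a \<bullet> x \<le> a \<bullet> z"
  shows "x \<notin> interior S"
proof
  assume "x \<in> interior S"
  moreover have "interior S \<subseteq> interior {z. a \<bullet> z \<ge> a \<bullet> x}"
    using assms by (intro interior_mono) auto
  ultimately show False
    using assms(1) by auto
qed

text \<open>The tie-break \<open>g\<close> selects an end of the edge on which \<open>f\<close> is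
  minimal.\<close>

lemma exists_lex_minimum:
  fixes f g :: "'a \<Rightarrow> real"
  assumes "finite C" "C \<noteq> {}"
  shows "\<exists>x\<in>C. (\<forall>z\<in>C. f x \<le> f z) \<and> (\<forall>z\<in>C. f z = f x \<longrightarrow> g x \<le> g z)"
proof -
  define u where "u = arg_min_on f C"
  have u: "u \<in> C" "\<And>z. z \<in> C \<Longrightarrow> f u \<le> f z"
    using assms by (auto simp: u_def arg_min_if_finite(1) arg_min_least)
  define D where "D = {z\<in>C. f z = f u}"
  have D: "finite D" "D \<noteq> {}"
    using assms u by (auto simp: D_def)
  define x where "x = arg_min_on g D"
  have "x \<in> D" "\<And>z. z \<in> D \<Longrightarrow> g x \<le> g z"
    using D by (auto simp: x_def arg_min_if_finite(1) arg_min_least)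
  then show ?thesis
    using u by (intro bexI[of _ x]) (auto simp: D_def)
qed

section \<open>Boundary points of a sumset\<close>

text \<open>The points of \<open>C\<close>, except the last one, on the edge of the convex hull whose
  counterclockwise direction is \<open>d\<close>.\<close>

definition edge_pts :: "(real^2) set \<Rightarrow> real^2 \<Rightarrow> (real^2) set" where
  "edge_pts C d = {x\<in>C. (\<forall>z\<in>C. rot d \<bullet> x \<le> rot d \<bullet> z) \<and> (\<exists>t>0. x + t *\<^sub>R d \<in> C)}"

lemma edge_pts_scaleR:
  assumes "c > 0" "x \<in> edge_pts C d"
  shows "x \<in> edge_pts C (c *\<^sub>R d)"
proof -
  obtain t where "t > 0" "x + t *\<^sub>R d \<in> C"
    using assms by (auto simp: edge_pts_def)
  then have "t / c > 0" "x + (t / c) *\<^sub>R (c *\<^sub>R d) \<in> C"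
    using assms by auto
  then show ?thesis
    using assms by (auto simp: edge_pts_def inner_rot_scaleR)
qed

lemma edge_pts_frontier:
  assumes "d \<noteq> 0" "x \<in> edge_pts C d"
  shows "x \<in> frontier (convex hull C)"
proof -
  have "x \<notin> interior (convex hull C)"
    using assms inner_convex_hull_ge[of C "rot d \<bullet> x" "rot d"]
    by (intro minimum_not_interior[of "rot d"]) (auto simp: edge_pts_def)
  moreover have "x \<in> convex hull C"
    using assms by (auto simp: edge_pts_def hull_inc)
  ultimately show ?thesis
    using closure_subset by (auto simp: frontier_def)
qed

text \<open>A supporting line through \<open>x\<close>, oriented with \<open>C\<close> on its left,
  either has a point of \<open>C\<close> ahead of \<open>x\<close> or can be turned counterclockwise
  about \<open>x\<close> until it has one.\<close>

lemma frontier_edge_pts: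
  assumes "finite C" "interior (convex hull C) \<noteq> {}"
    and x: "x \<in> C" "x \<in> frontier (convex hull C)"
  shows "\<exists>d. norm d = 1 \<and> x \<in> edge_pts C d"
proof -
  have "\<exists>d. d \<noteq> 0 \<and> x \<in> edge_pts C d"
  proof -
    have "rel_interior (convex hull C) = interior (convex hull C)"
      using assms(2) by (rule rel_interior_nonempty_interior)
    then obtain a where a: "a \<noteq> 0" "\<And>y. y \<in> convex hull C \<Longrightarrow> a \<bullet> x \<le> a \<bullet> y"
      using supporting_hyperplane_rel_boundary[of "convex hull C" x] x
      by (metis DiffD2 convex_convex_hull frontier_def hull_inc)
    \<comment> \<open>Two quarter turns negate, so this choice makes the inner normal
      \<open>a\<close> equal to \<open>rot e\<close>.\<close>
    define e where "e = rot (- a)"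
    have e: "e \<noteq> 0" and re: "rot e = a"
      using a by (simp_all add: e_def rot_rot)
    have supp: "rot e \<bullet> (z - x) \<ge> 0" if "z \<in> C" for z
      using a(2)[of z] that by (simp add: re hull_inc inner_diff_right)
    show ?thesis
    proof (cases "\<exists>t>0. x + t *\<^sub>R e \<in> C")
      case True
      then have "x \<in> edge_pts C e"
        using supp x by (auto simp: edge_pts_def inner_diff_right)
      with e show ?thesis by blast
    next
      case False
      \<comment> \<open>Rotate the supporting line about \<open>x\<close> until it meets a further point \<open>y\<close> of \<open>C\<close>.\<close>
      define Z where "Z = {z\<in>C. rot e \<bullet> (z - x) > 0}"
      \<comment> \<open>The cotangent of the angle from \<open>e\<close> to \<open>z - x\<close>:
        the turning line first hits the point where it is largest.\<close>
      define r where "r z = (e \<bullet> (z - x)) / (rot e \<bullet> (z - x))" for z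
      obtain z0 where "z0 \<in> C" "rot e \<bullet> z0 \<noteq> rot e \<bullet> x"
        using not_in_line[OF assms(2) e] by blast
      then have "z0 \<in> Z"
        using supp[of z0] by (auto simp: Z_def inner_diff_right)
      moreover have "finite Z"
        using assms(1) by (simp add: Z_def)
      ultimately have "\<exists>y\<in>Z. \<forall>z\<in>Z. r z \<le> r y"
        using exists_lex_minimum[of Z "\<lambda>z. - r z" "\<lambda>_. 0"] by auto
      then obtain y where y: "y \<in> Z" "\<And>z. z \<in> Z \<Longrightarrow> r z \<le> r y"
        by blast
      have "rot (y - x) \<bullet> (z - x) \<ge> 0" if z: "z \<in> C" for z
      proof -
        have pos: "rot e \<bullet> (y - x) > 0"
          using y by (simp add: Z_def)
        \<comment> \<open>After scaling by \<open>e \<bullet> e > 0\<close>, the determinant becomes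
          the comparison of \<open>r z\<close> with \<open>r y\<close>. Points outside
          \<open>Z\<close> lie on the line of direction \<open>e\<close>, not ahead of
          \<open>x\<close>.\<close>
        have "(e \<bullet> e) * (rot (y - x) \<bullet> (z - x)) \<ge> 0"
        proof (cases "z \<in> Z")
          case True
          then have "(e \<bullet> (z - x)) * (rot e \<bullet> (y - x)) \<le> (e \<bullet> (y - x)) * (rot e \<bullet> (z - x))"
            using y(2)[OF True] pos by (simp add: r_def Z_def pos_divide_le_eq pos_le_divide_eq mult.commute)
          then show ?thesis
            by (simp add: inner_rot_lagrange mult.commute)
        next
          case False': False
          then have 0: "rot e \<bullet> (z - x) = 0"
            using supp[OF z] z by (simp add: Z_def)
          then obtain t where t: "z - x = t *\<^sub>R e"
            using rot_parallel[OF e] by blast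
          then have "z = x + t *\<^sub>R e"
            by (simp add: algebra_simps)
          then have "t \<le> 0"
            using False z by (metis not_le)
          then have "e \<bullet> (z - x) \<le> 0"
            by (simp add: t mult_nonpos_nonneg)
          then show ?thesis
            using pos by (simp add: inner_rot_lagrange 0 mult_nonneg_nonpos)
        qed
        then show ?thesis
          using e by (metis inner_gt_zero_iff zero_le_mult_iff not_le)
      qed
      then have "x \<in> edge_pts C (y - x)"
        using x y(1) by (auto simp: edge_pts_def Z_def inner_diff_right intro!: exI[of _ 1])
      moreover have "y - x \<noteq> 0"
        using y(1) by (auto simp: Z_def)
      ultimately show ?thesis by blast
    qed
  qed
  then obtain d where "d \<noteq> 0" "x \<in> edge_pts C d" by blast
  then show ?thesis
    using edge_pts_scaleR[of "inverse (norm d)" x C d] by (intro exI[of _ "inverse (norm d) *\<^sub>R d"]) auto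
qed

text \<open>The point ahead of \<open>x\<close> on either edge lies weakly to the left of the other
  edge. By antisymmetry the determinant of \<open>d\<close> and \<open>e\<close> vanishes, and
  \<open>e = - d\<close> would squeeze \<open>C\<close> into a line.\<close>

lemma edge_pts_unique:
  assumes "interior (convex hull C) \<noteq> {}" "norm d = 1" "norm e = 1"
    and "x \<in> edge_pts C d" "x \<in> edge_pts C e"
  shows "d = e"
proof -
  have *: "rot d \<bullet> e \<ge> 0" if d: "x \<in> edge_pts C d" and e: "x \<in> edge_pts C e" for d e
  proof -
    obtain t where t: "t > 0" "x + t *\<^sub>R e \<in> C"
      using e by (auto simp: edge_pts_def)
    then have "rot d \<bullet> x \<le> rot d \<bullet> (x + t *\<^sub>R e)"
      using d by (auto simp: edge_pts_def)
    then show ?thesis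
      using t by (simp add: inner_add_right zero_le_mult_iff)
  qed
  have d0: "d \<noteq> 0"
    using assms by auto
  have "rot d \<bullet> e = 0"
    using *[of d e] *[of e d] assms inner_rot_commute[of d e] by simp
  then obtain t where t: "e = t *\<^sub>R d"
    using rot_parallel d0 by blast
  then have "\<bar>t\<bar> = 1"
    using assms by simp
  moreover have "t \<noteq> - 1"
  proof
    assume "t = - 1"
    then have "rot d \<bullet> z = rot d \<bullet> x" if "z \<in> C" for z
      using that assms(4,5) by (force simp: edge_pts_def t rot_uminus)
    then show False
      using not_in_line[OF assms(1) d0] by blast
  qed
  ultimately show ?thesis
    using t by (simp add: abs_if split: if_splits)
qed

text \<open>The translate by \<open>a\<close> of the interior is an open subset of the sum of the
  two hulls, which is the hull of the sum.\<close>

lemma interior_convex_hull_plus: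
  fixes A B :: "'a::euclidean_space set"
  assumes "a \<in> A" "b \<in> interior (convex hull B)"
  shows "a + b \<in> interior (convex hull (A + B))"
proof -
  have "open ((+) a ` interior (convex hull B))"
    by (intro open_translation open_interior)
  moreover have "(+) a ` interior (convex hull B) \<subseteq> convex hull (A + B)"
    using assms(1) interior_subset[of "convex hull B"]
    by (auto simp: convex_hull_set_plus hull_inc intro!: set_plus_intro)
  ultimately have "(+) a ` interior (convex hull B) \<subseteq> interior (convex hull (A + B))"
    by (rule interior_maximal[rotated])
  then show ?thesis
    using assms(2) by blast
qed

lemma edge_pts_plus:
  assumes "x \<in> edge_pts A d" "b \<in> B" "\<And>z. z \<in> B \<Longrightarrow> rot d \<bullet> b \<le> rot d \<bullet> z"
  shows "x + b \<in> edge_pts (A + B) d"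
proof -
  obtain t where t: "t > 0" "x + t *\<^sub>R d \<in> A"
    using assms by (auto simp: edge_pts_def)
  have "x + b + t *\<^sub>R d = (x + t *\<^sub>R d) + b"
    by simp
  also have "\<dots> \<in> A + B"
    using t assms by blast
  finally have "x + b + t *\<^sub>R d \<in> A + B" .
  moreover have "rot d \<bullet> (x + b) \<le> rot d \<bullet> w" if "w \<in> A + B" for w
  proof -
    from that obtain u v where "w = u + v" "u \<in> A" "v \<in> B"
      by (rule set_plus_elim)
    then show ?thesis
      using assms by (simp add: inner_add_right add_mono edge_pts_def)
  qed
  ultimately show ?thesis
    using assms t by (auto simp: edge_pts_def)
qed

text \<open>On the edge of \<open>A + B\<close> of direction \<open>d\<close>, the edge points of
  \<open>A\<close> are placed first, shifted by the first point \<open>m d\<close> of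
  \<open>B\<close>; those of \<open>B\<close> follow, shifted by the last point \<open>l d\<close>
  of \<open>A\<close>. Uniqueness of directions keeps different edges apart, so the two shifts are
  injective with disjoint images.\<close>

lemma bd_pts_plus:
  assumes fin: "finite A" "finite B"
    and int: "interior (convex hull A) \<noteq> {}" "interior (convex hull B) \<noteq> {}"
  shows "bd_pts A + bd_pts B \<le> bd_pts (A + B)"
proof -
  have ne: "A \<noteq> {}" "B \<noteq> {}"
    using int by auto
  have intAB: "interior (convex hull (A + B)) \<noteq> {}"
    using interior_convex_hull_plus ne int by blast
  \<comment> \<open>The negated tie-break makes \<open>l d\<close> the last minimizer along
    \<open>d\<close>; below, \<open>m d\<close> is the first one.\<close>
  have "\<exists>l. \<forall>d. l d \<in> A \<and> (\<forall>z\<in>A. rot d \<bullet> l d \<le> rot d \<bullet> z) \<and>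
      (\<forall>z\<in>A. rot d \<bullet> z = rot d \<bullet> l d \<longrightarrow> - (d \<bullet> l d) \<le> - (d \<bullet> z))"
  proof (intro choice allI)
    fix d
    show "\<exists>x. x \<in> A \<and> (\<forall>z\<in>A. rot d \<bullet> x \<le> rot d \<bullet> z) \<and>
      (\<forall>z\<in>A. rot d \<bullet> z = rot d \<bullet> x \<longrightarrow> - (d \<bullet> x) \<le> - (d \<bullet> z))"
      using exists_lex_minimum[OF fin(1) ne(1), of "\<lambda>z. rot d \<bullet> z" "\<lambda>z. - (d \<bullet> z)"] by blast
  qed
  then obtain l where l: "\<And>d. l d \<in> A" "\<And>d z. z \<in> A \<Longrightarrow> rot d \<bullet> l d \<le> rot d \<bullet> z"
      "\<And>d z. z \<in> A \<Longrightarrow> rot d \<bullet> z = rot d \<bullet> l d \<Longrightarrow> d \<bullet> z \<le> d \<bullet> l d"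
    by auto
  have "\<exists>m. \<forall>d. m d \<in> B \<and> (\<forall>z\<in>B. rot d \<bullet> m d \<le> rot d \<bullet> z) \<and>
      (\<forall>z\<in>B. rot d \<bullet> z = rot d \<bullet> m d \<longrightarrow> d \<bullet> m d \<le> d \<bullet> z)"
  proof (intro choice allI)
    fix d
    show "\<exists>x. x \<in> B \<and> (\<forall>z\<in>B. rot d \<bullet> x \<le> rot d \<bullet> z) \<and>
      (\<forall>z\<in>B. rot d \<bullet> z = rot d \<bullet> x \<longrightarrow> d \<bullet> x \<le> d \<bullet> z)"
      using exists_lex_minimum[OF fin(2) ne(2), of "\<lambda>z. rot d \<bullet> z" "\<lambda>z. d \<bullet> z"] by blast
  qed
  then obtain m where m: "\<And>d. m d \<in> B" "\<And>d z. z \<in> B \<Longrightarrow> rot d \<bullet> m d \<le> rot d \<bullet> z"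
      "\<And>d z. z \<in> B \<Longrightarrow> rot d \<bullet> z = rot d \<bullet> m d \<Longrightarrow> d \<bullet> m d \<le> d \<bullet> z"
    by auto
  define bA where "bA = A \<inter> frontier (convex hull A)"
  define bB where "bB = B \<inter> frontier (convex hull B)"
  define bAB where "bAB = (A + B) \<inter> frontier (convex hull (A + B))"
  obtain dA where dA: "\<And>x. x \<in> bA \<Longrightarrow> norm (dA x) = 1 \<and> x \<in> edge_pts A (dA x)"
    using frontier_edge_pts[OF fin(1) int(1)] unfolding bA_def by (metis IntD1 IntD2)
  obtain dB where dB: "\<And>x. x \<in> bB \<Longrightarrow> norm (dB x) = 1 \<and> x \<in> edge_pts B (dB x)"
    using frontier_edge_pts[OF fin(2) int(2)] unfolding bB_def by (metis IntD1 IntD2)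
  define f where "f x = x + m (dA x)" for x
  define g where "g y = l (dB y) + y" for y
  have f: "f x \<in> edge_pts (A + B) (dA x)" if "x \<in> bA" for x
    using dA[OF that] m unfolding f_def by (intro edge_pts_plus) auto
  have g: "g y \<in> edge_pts (A + B) (dB y)" if "y \<in> bB" for y
  proof -
    have "y + l (dB y) \<in> edge_pts (B + A) (dB y)"
      using dB[OF that] l by (intro edge_pts_plus) auto
    then show ?thesis
      by (simp add: g_def add.commute)
  qed
  have "inj_on f bA"
  proof (rule inj_onI)
    fix x y assume xy: "x \<in> bA" "y \<in> bA" "f x = f y"
    then have "dA x = dA y"
      using f[of x] f[of y] dA[of x] dA[of y] by (intro edge_pts_unique[OF intAB]) auto
    with xy(3) show "x = y"
      by (simp add: f_def)
  qed
  moreover have "inj_on g bB"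
  proof (rule inj_onI)
    fix x y assume xy: "x \<in> bB" "y \<in> bB" "g x = g y"
    then have "dB x = dB y"
      using g[of x] g[of y] dB[of x] dB[of y] by (intro edge_pts_unique[OF intAB]) auto
    with xy(3) show "x = y"
      by (simp add: g_def)
  qed
  moreover have "f ` bA \<inter> g ` bB = {}"
  proof (rule ccontr)
    assume "f ` bA \<inter> g ` bB \<noteq> {}"
    then obtain x y where xy: "x \<in> bA" "y \<in> bB" "f x = g y"
      by auto
    then have "dA x = dB y"
      using f[of x] g[of y] dA[of x] dB[of y] by (intro edge_pts_unique[OF intAB]) auto
    then obtain d where d: "d = dA x" "d = dB y" by blast
    have eq: "x + m d = l d + y"
      using xy d by (simp add: f_def g_def)
    have x: "x \<in> edge_pts A d" "norm d = 1" and y: "y \<in> edge_pts B d"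
      using dA[OF xy(1)] dB[OF xy(2)] d by auto
    then obtain t where t: "t > 0" "x + t *\<^sub>R d \<in> A"
      by (auto simp: edge_pts_def)
    have "rot d \<bullet> x = rot d \<bullet> l d"
      using x l(1)[of d] l(2)[of x d] by (auto simp: edge_pts_def intro: antisym)
    \<comment> \<open>The point ahead of \<open>x\<close> comes no later than \<open>l d\<close>, so
      \<open>x\<close> comes strictly before it. This strictness rules out a common image.\<close>
    then have "d \<bullet> (x + t *\<^sub>R d) \<le> d \<bullet> l d"
      using l(3)[OF t(2)] by (simp add: inner_add_right)
    moreover have "d \<bullet> d = 1"
      using x by (simp add: dot_square_norm)
    ultimately have "d \<bullet> x < d \<bullet> l d"
      using t by (simp add: inner_add_right)
    moreover have "rot d \<bullet> y = rot d \<bullet> m d"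
      using y m(1)[of d] m(2)[of y d] by (auto simp: edge_pts_def intro: antisym)
    then have "d \<bullet> m d \<le> d \<bullet> y"
      using m(3) y by (simp add: edge_pts_def)
    ultimately have "d \<bullet> (x + m d) < d \<bullet> (l d + y)"
      by (simp add: inner_add_right)
    then show False
      by (simp add: eq)
  qed
  moreover have "f ` bA \<union> g ` bB \<subseteq> bAB"
  proof -
    have "z \<in> bAB" if "norm d = 1" "z \<in> edge_pts (A + B) d" for z d
    proof -
      have "d \<noteq> 0"
        using that by auto
      then show ?thesis
        using that edge_pts_frontier[of d z "A + B"] by (auto simp: bAB_def edge_pts_def)
    qed
    then show ?thesis
      using f g dA dB by blast
  qed
  moreover have "finite bA" "finite bB" "finite bAB"
    using fin by (auto simp: bA_def bB_def bAB_def finite_set_plus)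
  ultimately have "card bA + card bB \<le> card bAB"
    by (metis card_Un_disjoint card_image card_mono finite_imageI)
  then show ?thesis
    by (simp add: bd_pts_def bA_def bB_def bAB_def)
qed

section \<open>Interior points of a sumset\<close>

lemma card_eq_int_pts_bd_pts:
  assumes "finite C"
  shows "card C = int_pts C + bd_pts C"
proof -
  have "closed (convex hull C)"
    using assms by (simp add: finite_imp_compact_convex_hull compact_imp_closed)
  then have "C = (C \<inter> interior (convex hull C)) \<union> (C \<inter> frontier (convex hull C))"
    using hull_inc[of _ C convex] by (auto simp: frontier_def)
  moreover have "(C \<inter> interior (convex hull C)) \<inter> (C \<inter> frontier (convex hull C)) = {}"
    by (auto simp: frontier_def)
  ultimately show ?thesis
    using assms unfolding int_pts_def bd_pts_def by (metis card_Un_disjoint finite_Int)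
qed

text \<open>Translation by an interior point of \<open>B\<close> sends every point of
  \<open>A\<close>, boundary points included, into the interior.\<close>

lemma int_pts_plus:
  assumes "finite A" "finite B" "interior (convex hull B) \<inter> B \<noteq> {}"
  shows "card A \<le> int_pts (A + B)"
proof -
  obtain b where b: "b \<in> B" "b \<in> interior (convex hull B)"
    using assms by blast
  have "(\<lambda>a. a + b) ` A \<subseteq> (A + B) \<inter> interior (convex hull (A + B))"
    using b interior_convex_hull_plus by blast
  moreover have "inj_on (\<lambda>a. a + b) A"
    by (simp add: inj_on_def)
  ultimately show ?thesis
    using assms unfolding int_pts_def by (metis card_image card_mono finite_Int finite_set_plus)
qed

section \<open>The number of triangles in a triangulation\<close>

lemma open_segment_on_line:
  fixes d :: "'a::real_vector"
  assumes "d \<noteq> 0" "a < c" "c < b"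
  shows "v + c *\<^sub>R d \<in> open_segment (v + a *\<^sub>R d) (v + b *\<^sub>R d)"
proof -
  define u where "u = (c - a) / (b - a)"
  have u01: "0 < u" "u < 1" and "u * (b - a) = c - a"
    using assms by (auto simp: u_def)
  then have c: "c = (1 - u) * a + u * b"
    by (simp add: algebra_simps)
  have "v + c *\<^sub>R d = (1 - u) *\<^sub>R (v + a *\<^sub>R d) + u *\<^sub>R (v + b *\<^sub>R d)"
    unfolding c by (simp add: algebra_simps)
  then show ?thesis
    using u01 assms by (auto simp: in_segment)
qed

lemma convex_ray:
  fixes v d :: "'a::real_vector"
  assumes "convex K" "v \<in> K" "v + (\<epsilon> * s) *\<^sub>R d \<in> K" "0 \<le> \<eta>" "\<eta> \<le> \<epsilon>" "0 < \<epsilon>"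
  shows "v + (\<eta> * s) *\<^sub>R d \<in> K"
proof -
  have "v + (\<eta> * s) *\<^sub>R d = (1 - \<eta> / \<epsilon>) *\<^sub>R v + (\<eta> / \<epsilon>) *\<^sub>R (v + (\<epsilon> * s) *\<^sub>R d)"
    using assms by (simp add: algebra_simps)
  also have "\<dots> \<in> K"
    using assms by (intro convexD) auto
  finally show ?thesis .
qed

text \<open>Any weight that a convex combination puts on points other than \<open>p\<close> raises
  its value strictly above that at \<open>p\<close>.\<close>

lemma convex_hull_unique_minimum:
  fixes a :: "'a::real_inner"
  assumes C: "\<And>z. z \<in> C \<Longrightarrow> z \<noteq> p \<Longrightarrow> a \<bullet> p < a \<bullet> z"
    and y: "y \<in> convex hull C" "a \<bullet> y \<le> a \<bullet> p"
  shows "y = p"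
proof (cases "C - {p} = {}")
  case True
  then have "convex hull C \<subseteq> {p}"
    by (intro hull_minimal) auto
  then show ?thesis
    using y by auto
next
  case False
  define H where "H = C - {p}"
  have H: "convex hull H \<subseteq> {z. a \<bullet> z > a \<bullet> p}"
    using C by (intro hull_minimal) (auto simp: convex_halfspace_gt H_def)
  have "y \<in> convex hull (insert p H)"
    using y hull_mono[of C "insert p H" convex] by (auto simp: H_def)
  then obtain u v b where uvb: "u \<ge> 0" "v \<ge> 0" "u + v = 1" "b \<in> convex hull H" "y = u *\<^sub>R p + v *\<^sub>R b"
    using convex_hull_insert[of H p] False unfolding H_def by blast
  have "u = 1 - v"
    using uvb(3) by simp
  then have "a \<bullet> y = a \<bullet> p + v * (a \<bullet> b - a \<bullet> p)"
    by (simp only: uvb(5)) (simp add: inner_add_right algebra_simps)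
  then have "v * (a \<bullet> b - a \<bullet> p) \<le> 0"
    using y by simp
  then have "v = 0"
    using H uvb by (auto simp: mult_le_0_iff)
  then show ?thesis
    using uvb by simp
qed

text \<open>By interpolation the side from \<open>p\<close> to \<open>q\<close> has an interior
  point at the height of \<open>v\<close>, so it differs from \<open>v\<close> by a multiple of
  \<open>d\<close>. The multiple is nonzero because \<open>v\<close> is extreme.\<close>

lemma triangle_middle_vertex:
  assumes T: "2 simplex T" and "d \<noteq> 0"
    and inj: "inj_on (\<lambda>z. rot d \<bullet> z) {x. x extreme_point_of T}"
  obtains p v q t where "T = convex hull {p, v, q}" "{x. x extreme_point_of T} = {p, v, q}"
    "rot d \<bullet> p < rot d \<bullet> v" "rot d \<bullet> v < rot d \<bullet> q" "t \<noteq> 0" "v + t *\<^sub>R d \<in> open_segment p q"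
proof -
  obtain S where S: "\<not> affine_dependent S" "int (card S) = 2 + 1" "T = convex hull S"
    using T by (auto simp: simplex_def)
  have ext: "{x. x extreme_point_of T} = S"
    using extreme_point_of_convex_hull_affine_independent[OF S(1)] S(3) by auto
  have "card S = 3"
    using S(2) by simp
  then obtain a b c where abc: "S = {a, b, c}" "a \<noteq> b" "a \<noteq> c" "b \<noteq> c"
    by (auto simp: card_3_iff)
  define f where "f z = rot d \<bullet> z" for z
  have "f a \<noteq> f b" "f a \<noteq> f c" "f b \<noteq> f c"
    using inj abc unfolding ext f_def by (auto simp: inj_on_def)
  then consider "f a < f b" "f b < f c" | "f a < f c" "f c < f b" | "f b < f a" "f a < f c"
    | "f b < f c" "f c < f a" | "f c < f a" "f a < f b" | "f c < f b" "f b < f a"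
    by linarith
  then have "\<exists>p v q. S = {p, v, q} \<and> f p < f v \<and> f v < f q"
  proof cases
    case 1 then show ?thesis using abc(1) by (intro exI[of _ a] exI[of _ b] exI[of _ c]) auto
  next
    case 2 then show ?thesis using abc(1) by (intro exI[of _ a] exI[of _ c] exI[of _ b]) auto
  next
    case 3 then show ?thesis using abc(1) by (intro exI[of _ b] exI[of _ a] exI[of _ c]) auto
  next
    case 4 then show ?thesis using abc(1) by (intro exI[of _ b] exI[of _ c] exI[of _ a]) auto
  next
    case 5 then show ?thesis using abc(1) by (intro exI[of _ c] exI[of _ a] exI[of _ b]) auto
  next
    case 6 then show ?thesis using abc(1) by (intro exI[of _ c] exI[of _ b] exI[of _ a]) auto
  qed
  then obtain p v q where pvq: "S = {p, v, q}" "f p < f v" "f v < f q"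
    by blast
  define u where "u = (f v - f p) / (f q - f p)"
  define w where "w = (1 - u) *\<^sub>R p + u *\<^sub>R q"
  have u: "0 < u" "u < 1" "u * (f q - f p) = f v - f p"
    using pvq by (auto simp: u_def field_simps)
  have w: "w \<in> open_segment p q"
    using u pvq by (auto simp: in_segment w_def)
  have "rot d \<bullet> (w - v) = 0"
    using u(3) by (simp add: w_def f_def inner_add_right inner_diff_right algebra_simps)
  then obtain t where t: "w - v = t *\<^sub>R d"
    using rot_parallel assms(2) by blast
  then have wt: "w = v + t *\<^sub>R d"
    by (simp add: algebra_simps)
  have "v extreme_point_of T" "p \<in> T" "q \<in> T"
    using ext pvq S(3) by (auto simp: hull_inc)
  then have "v \<notin> open_segment p q"
    by (auto simp: extreme_point_of_def)
  then have "t \<noteq> 0"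
    using w wt by auto
  then show ?thesis
    using that[of p v q t] S(3) ext pvq w wt by (simp add: f_def)
qed

text \<open>The ray from \<open>v\<close> in direction \<open>s d\<close> meets \<open>S\<close>; for a convex set \<open>S\<close> containing \<open>v\<close> this means
  that it starts inside \<open>S\<close>.\<close>

definition enters :: "real^2 \<Rightarrow> (real^2) set \<Rightarrow> real^2 \<Rightarrow> real \<Rightarrow> bool" where
  "enters d S v s \<longleftrightarrow> s \<in> {1, -1} \<and> (\<exists>\<epsilon>>0. v + (\<epsilon> * s) *\<^sub>R d \<in> S)"

text \<open>Excludes entry from \<open>v\<close> in both directions: \<open>v\<close> would lie
  strictly between two points of the set.\<close>

lemma open_segment_opposite:
  fixes v d :: "'a::real_vector"
  assumes "d \<noteq> 0" "t \<noteq> 0" "\<epsilon> > 0" "r \<in> {1, -1}" "r \<noteq> sgn t"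
  shows "v \<in> open_segment (v + t *\<^sub>R d) (v + (\<epsilon> * r) *\<^sub>R d)"
proof (cases "t > 0")
  case True
  then have "\<epsilon> * r < 0"
    using assms by auto
  then show ?thesis
    using open_segment_on_line[OF assms(1), of "\<epsilon> * r" 0 t v] True
    by (simp add: open_segment_commute)
next
  case False
  then have "\<epsilon> * r > 0"
    using assms by auto
  then show ?thesis
    using open_segment_on_line[OF assms(1), of t 0 "\<epsilon> * r" v] False assms(2) by simp
qed

text \<open>The lowest and the highest vertex are alone at their heights, so only the middle one can
  start a ray into \<open>T\<close>, and only in one direction. A face entered from there reaches
  the relative interior of the opposite side, hence contains all three vertices.\<close>

lemma enters_triangle:
  assumes T: "2 simplex T" and d: "d \<noteq> 0"
    and inj: "inj_on (\<lambda>z. rot d \<bullet> z) {x. x extreme_point_of T}"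
  obtains v s where "v extreme_point_of T" "enters d T v s"
    "\<And>x r. x extreme_point_of T \<Longrightarrow> enters d T x r \<Longrightarrow> x = v \<and> r = s"
    "\<And>F r. F face_of T \<Longrightarrow> v \<in> F \<Longrightarrow> enters d F v r \<Longrightarrow> F = T"
proof -
  obtain p v q t where pvq: "T = convex hull {p, v, q}" "{x. x extreme_point_of T} = {p, v, q}"
    "rot d \<bullet> p < rot d \<bullet> v" "rot d \<bullet> v < rot d \<bullet> q" "t \<noteq> 0" "v + t *\<^sub>R d \<in> open_segment p q"
    using triangle_middle_vertex[OF assms] .
  have pqT: "p \<in> T" "q \<in> T" "v \<in> T"
    by (auto simp: pvq(1) hull_inc)
  have "convex T"
    by (simp add: pvq(1))
  then have wT: "v + t *\<^sub>R d \<in> T"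
    using pvq(6) pqT by (meson convex_contains_open_segment subset_iff)
  have v: "v extreme_point_of T"
    using pvq(2) by blast
  have ent: "enters d T v (sgn t)"
    using wT pvq(5) unfolding enters_def
    by (auto simp: sgn_if intro!: exI[of _ "\<bar>t\<bar>"])
  have sgn: "r = sgn t" if r: "enters d T v r" for r
  proof (rule ccontr)
    assume ne: "r \<noteq> sgn t"
    obtain \<epsilon> where \<epsilon>: "\<epsilon> > 0" "v + (\<epsilon> * r) *\<^sub>R d \<in> T" and "r \<in> {1, -1}"
      using r by (auto simp: enters_def)
    then have "v \<in> open_segment (v + t *\<^sub>R d) (v + (\<epsilon> * r) *\<^sub>R d)"
      using ne pvq(5) d by (intro open_segment_opposite) auto
    then show False
      using v wT \<epsilon>(2) by (simp add: extreme_point_of_def)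
  qed
  have mid: "x = v" if x: "x extreme_point_of T" and r: "enters d T x r" for x r
  proof -
    obtain \<epsilon> where \<epsilon>: "\<epsilon> > 0" "x + (\<epsilon> * r) *\<^sub>R d \<in> T" and "r \<in> {1, -1}"
      using r by (auto simp: enters_def)
    then have ne: "x + (\<epsilon> * r) *\<^sub>R d \<noteq> x"
      using d by auto
    have "p + (\<epsilon> * r) *\<^sub>R d = p" if "x = p"
      using pvq(1,3,4) \<epsilon> that
      by (intro convex_hull_unique_minimum[of "{p, v, q}" p "rot d"]) (auto simp: inner_add_right)
    moreover have "q + (\<epsilon> * r) *\<^sub>R d = q" if "x = q"
      using pvq(1,3,4) \<epsilon> that
      by (intro convex_hull_unique_minimum[of "{p, v, q}" q "- rot d"]) (auto simp: inner_add_right)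
    moreover have "x \<in> {p, v, q}"
      using x pvq(2) by blast
    ultimately show ?thesis
      using ne by (metis insertE singletonD)
  qed
  have face: "F = T" if F: "F face_of T" "v \<in> F" "enters d F v r" for F r
  proof -
    have FT: "F \<subseteq> T" "convex F"
      using F by (auto simp: face_of_imp_subset face_of_imp_convex)
    then have "enters d T v r"
      using F by (auto simp: enters_def)
    then have r: "r = sgn t"
      by (rule sgn)
    obtain \<epsilon> where \<epsilon>: "\<epsilon> > 0" "v + (\<epsilon> * r) *\<^sub>R d \<in> F"
      using F by (auto simp: enters_def)
    \<comment> \<open>If the known point of \<open>F\<close> lies before the opposite side, the face
      property extends \<open>F\<close> to that side; otherwise convexity suffices.\<close>
    have w: "v + t *\<^sub>R d \<in> F"
    proof (cases "\<epsilon> < \<bar>t\<bar>")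
      case True
      then have "v + (\<epsilon> * r) *\<^sub>R d \<in> open_segment (v + 0 *\<^sub>R d) (v + t *\<^sub>R d)"
        using open_segment_on_line[OF d, of 0 "\<epsilon> * r" t v]
          open_segment_on_line[OF d, of t "\<epsilon> * r" 0 v] \<epsilon> r pvq(5)
        by (auto simp: sgn_if open_segment_commute split: if_splits)
      then show ?thesis
        using face_ofD[OF F(1) _ pqT(3) wT \<epsilon>(2)] by simp
    next
      case False
      then have "v + (\<bar>t\<bar> * r) *\<^sub>R d \<in> F"
        by (intro convex_ray[OF FT(2) F(2) \<epsilon>(2) _ _ \<epsilon>(1)]) auto
      then show ?thesis
        by (simp add: r abs_mult_sgn)
    qed
    have "p \<in> F" "q \<in> F"
      using face_ofD[OF F(1) pvq(6) pqT(1,2) w] by auto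
    then have "T \<subseteq> F"
      unfolding pvq(1) using F FT by (intro hull_minimal) auto
    then show ?thesis
      using FT by blast
  qed
  show ?thesis
    using that[OF v ent] sgn mid face by blast
qed

text \<open>Double counting of the triples \<open>(T, v, s)\<close> in \<open>R\<close>: projection
  to \<open>T\<close> is a bijection onto \<open>\<T>\<close>, and projection to
  \<open>(v, s)\<close> is a bijection onto the rays from points of \<open>C\<close> that enter the
  hull.\<close>

lemma card_triangulation_eq_enters:
  assumes tri: "triangulates \<T> C" and "finite C" and d: "d \<noteq> 0"
    and inj: "inj_on (\<lambda>z. rot d \<bullet> z) C"
  shows "card \<T> = card (SIGMA v:C. {s. enters d (convex hull C) v s})"
proof -
  have fin: "finite \<T>" and face: "\<And>T T'. T \<in> \<T> \<Longrightarrow> T' \<in> \<T> \<Longrightarrow> T \<inter> T' face_of T"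
    and simp: "\<And>T. T \<in> \<T> \<Longrightarrow> 2 simplex T" and Un: "\<Union>\<T> = convex hull C"
    and vert: "(\<Union>T\<in>\<T>. {x. x extreme_point_of T}) = C"
    using tri by (auto simp: triangulates_def triangulation_def)
  have injT: "inj_on (\<lambda>z. rot d \<bullet> z) {x. x extreme_point_of T}" if "T \<in> \<T>" for T
    using inj vert that by (auto intro: inj_on_subset)
  define R where "R = {(T, v, s). T \<in> \<T> \<and> v extreme_point_of T \<and> enters d T v s}"
  have "inj_on fst R"
  proof (rule inj_onI, clarsimp simp: R_def)
    fix T v s v' s'
    assume *: "T \<in> \<T>" "v extreme_point_of T" "enters d T v s" "v' extreme_point_of T" "enters d T v' s'"
    show "v = v' \<and> s = s'"
      using enters_triangle[OF simp d injT] * by metis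
  qed
  moreover have "fst ` R = \<T>"
  proof -
    have "\<exists>v s. v extreme_point_of T \<and> enters d T v s" if "T \<in> \<T>" for T
      using enters_triangle[OF simp d injT] that by metis
    then show ?thesis
      by (force simp: R_def)
  qed
  ultimately have 1: "card R = card \<T>"
    using card_image by fastforce
  have "inj_on snd R"
  proof (rule inj_onI, clarsimp simp: R_def)
    fix T T' v s
    assume *: "T \<in> \<T>" "v extreme_point_of T" "enters d T v s"
      "T' \<in> \<T>" "v extreme_point_of T'" "enters d T' v s"
    have v: "v \<in> T" "v \<in> T'"
      using * by (auto simp: extreme_point_of_def)
    \<comment> \<open>The common face of two triangles entered by the same ray is itself entered, so
      it equals both.\<close>
    have "enters d (T \<inter> T') v s"
    proof -
      obtain \<epsilon> \<delta> where \<epsilon>: "\<epsilon> > 0" "v + (\<epsilon> * s) *\<^sub>R d \<in> T" and \<delta>: "\<delta> > 0" "v + (\<delta> * s) *\<^sub>R d \<in> T'"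
        using * by (auto simp: enters_def)
      have "v + (min \<epsilon> \<delta> * s) *\<^sub>R d \<in> T \<inter> T'"
        using convex_ray[OF convex_simplex[OF simp[OF *(1)]] v(1) \<epsilon>(2) _ _ \<epsilon>(1), of "min \<epsilon> \<delta>"]
          convex_ray[OF convex_simplex[OF simp[OF *(4)]] v(2) \<delta>(2) _ _ \<delta>(1), of "min \<epsilon> \<delta>"] \<epsilon>(1) \<delta>(1)
        by simp
      then show ?thesis
        using * \<epsilon> \<delta> unfolding enters_def by (metis min_less_iff_conj)
    qed
    moreover have "F = K" if "K \<in> \<T>" "F face_of K" "v extreme_point_of K" "v \<in> F" "enters d F v s" for F K
    proof -
      have "enters d K v s"
        using that face_of_imp_subset unfolding enters_def by blast
      then show ?thesis
        using enters_triangle[OF simp d injT, OF that(1) that(1)] that by metis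
    qed
    ultimately have "T \<inter> T' = T" "T \<inter> T' = T'"
      using * v face[of T T'] face[of T' T] by (auto simp: Int_commute)
    then show "T = T'"
      by simp
  qed
  moreover have "snd ` R = (SIGMA v:C. {s. enters d (convex hull C) v s})"
  proof -
    have "\<exists>T\<in>\<T>. v extreme_point_of T \<and> enters d T v s"
      if v: "v \<in> C" and s: "enters d (convex hull C) v s" for v s
    proof -
      obtain \<epsilon> where \<epsilon>: "\<epsilon> > 0" "v + (\<epsilon> * s) *\<^sub>R d \<in> convex hull C" and s1: "s \<in> {1, -1}"
        using s by (auto simp: enters_def)
      \<comment> \<open>A short enough step along the ray avoids this closed set, so the triangle it
        lands in contains \<open>v\<close>.\<close>
      define U where "U = \<Union>{T\<in>\<T>. v \<notin> T}"
      have "closed U"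
        using fin simp closed_simplex unfolding U_def by (intro closed_Union) auto
      then have "open (- U)" "v \<in> - U"
        by (auto simp: U_def)
      then obtain e where e: "e > 0" "ball v e \<subseteq> - U"
        by (meson open_contains_ball)
      define \<eta> where "\<eta> = min \<epsilon> (e / (2 * norm d))"
      have \<eta>: "\<eta> > 0" "\<eta> \<le> \<epsilon>" "\<eta> * norm d < e"
      proof -
        show "\<eta> > 0" "\<eta> \<le> \<epsilon>" using \<epsilon> e d by (auto simp: \<eta>_def)
        have "\<eta> * norm d \<le> e / (2 * norm d) * norm d"
          by (intro mult_right_mono) (auto simp: \<eta>_def)
        also have "\<dots> < e" using d e by simp
        finally show "\<eta> * norm d < e" .
      qed
      have "v + (\<eta> * s) *\<^sub>R d \<in> convex hull C"
        by (rule convex_ray[OF convex_convex_hull hull_inc[OF v] \<epsilon>(2) less_imp_le[OF \<eta>(1)] \<eta>(2) \<epsilon>(1)])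
      then obtain T where T: "T \<in> \<T>" "v + (\<eta> * s) *\<^sub>R d \<in> T"
        using Un by blast
      have "v + (\<eta> * s) *\<^sub>R d \<in> ball v e"
        using s1 \<eta> by (auto simp: dist_norm)
      then have "v \<in> T"
        using e(2) T by (auto simp: U_def)
      \<comment> \<open>Being a vertex passes from \<open>T'\<close> to the common face and from
        there to \<open>T\<close>.\<close>
      obtain T' where T': "T' \<in> \<T>" "v extreme_point_of T'"
        using vert v by blast
      then have "v \<in> T'"
        by (auto simp: extreme_point_of_def)
      then have "v extreme_point_of (T' \<inter> T)"
        using extreme_point_of_face[OF face[OF T'(1) T(1)]] T' \<open>v \<in> T\<close> by auto
      then have "v extreme_point_of T"
        using extreme_point_of_face[OF face[OF T(1) T'(1)]] by (simp add: inf_commute)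
      then show ?thesis
        using T \<eta> s1 by (auto simp: enters_def)
    qed
    moreover have "v \<in> C \<and> enters d (convex hull C) v s"
      if "T \<in> \<T>" "v extreme_point_of T" "enters d T v s" for T v s
      using that vert Un by (fastforce simp: enters_def)
    ultimately show ?thesis
      by (force simp: R_def)
  qed
  ultimately have "card R = card (SIGMA v:C. {s. enters d (convex hull C) v s})"
    using card_image by fastforce
  with 1 show ?thesis by simp
qed

section \<open>Generic heights and the number of rays at each kind of point\<close>

lemma exists_generic_direction:
  assumes "finite C"
  shows "\<exists>d. d \<noteq> 0 \<and> inj_on (\<lambda>z. rot d \<bullet> z) C"
proof -
  \<comment> \<open>The slopes to avoid. Pairs with equal first coordinates contribute the default
    quotient 0; they are separated by their second coordinates.\<close>
  define X where "X = (\<lambda>(x, y). (x$2 - y$2) / (x$1 - y$1)) ` (C \<times> C)"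
  have "finite X"
    using assms by (simp add: X_def)
  then obtain t where t: "t \<notin> X"
    using ex_new_if_finite infinite_UNIV_char_0 by blast
  define d :: "real^2" where "d = vector [1, t]"
  have "d \<noteq> 0"
    by (auto simp: d_def vec_eq_iff forall_2)
  moreover have "inj_on (\<lambda>z. rot d \<bullet> z) C"
  proof (rule inj_onI)
    fix x y assume xy: "x \<in> C" "y \<in> C" "rot d \<bullet> x = rot d \<bullet> y"
    then have eq: "x$2 - y$2 = t * (x$1 - y$1)"
      by (simp add: inner_rot d_def algebra_simps)
    have "x$1 = y$1"
    proof (rule ccontr)
      assume "x$1 \<noteq> y$1"
      then have "t = (x$2 - y$2) / (x$1 - y$1)"
        using eq by simp
      then show False
        using t xy by (force simp: X_def)
    qed
    then show "x = y"
      using eq by (simp add: vec_eq_iff forall_2)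
  qed
  ultimately show ?thesis by blast
qed

lemma enters_interior:
  assumes "v \<in> interior S" "d \<noteq> 0"
  shows "{s. enters d S v s} = {1, -1}"
proof -
  obtain e where e: "e > 0" "ball v e \<subseteq> S"
    using assms by (meson mem_interior)
  define \<epsilon> where "\<epsilon> = e / (2 * norm d)"
  have \<epsilon>: "\<epsilon> > 0" "\<epsilon> * norm d < e"
    using e assms by (auto simp: \<epsilon>_def)
  then have "v + (\<epsilon> * s) *\<^sub>R d \<in> S" if "s \<in> {1, -1}" for s
    using e that by (intro subsetD[OF e(2)]) (auto simp: dist_norm)
  then show ?thesis
    using \<epsilon> unfolding enters_def by blast
qed

text \<open>\<open>c\<close> is 1 for the lowest point and -1 for the highest. The ray stays at the
  height of \<open>v\<close>, where the hull contains at most \<open>v\<close>.\<close>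

lemma enters_extremal:
  assumes "d \<noteq> 0" "c \<noteq> 0" "\<And>z. z \<in> C \<Longrightarrow> z \<noteq> v \<Longrightarrow> c * (rot d \<bullet> v) < c * (rot d \<bullet> z)"
  shows "{s. enters d (convex hull C) v s} = {}"
proof -
  have "v + (\<epsilon> * s) *\<^sub>R d \<notin> convex hull C" if "\<epsilon> > 0" "s \<in> {1, -1}" for \<epsilon> s
    using convex_hull_unique_minimum[of C v "c *\<^sub>R rot d" "v + (\<epsilon> * s) *\<^sub>R d"] assms that
    by (auto simp: inner_add_right)
  then show ?thesis
    unfolding enters_def by blast
qed

text \<open>Interior points of the hull are dense in it, so some lie below and some above
  \<open>v\<close>; a segment joining two of them crosses the line through \<open>v\<close> at an
  interior point \<open>w\<close>. Entry on the side away from \<open>w\<close> as well would make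
  \<open>v\<close> interior.\<close>

lemma enters_frontier:
  assumes int: "interior (convex hull C) \<noteq> {}" and d: "d \<noteq> 0"
    and v: "v \<in> C" "v \<in> frontier (convex hull C)"
    and pq: "p \<in> C" "q \<in> C" "rot d \<bullet> p < rot d \<bullet> v" "rot d \<bullet> v < rot d \<bullet> q"
  shows "card {s. enters d (convex hull C) v s} = 1"
proof -
  define H where "H = convex hull C"
  have H: "convex H" "v \<in> H" "p \<in> H" "q \<in> H"
    using v pq by (auto simp: H_def hull_inc)
  have vi: "v \<notin> interior H"
    using v by (auto simp: H_def frontier_def)
  have dense: "H \<subseteq> closure (interior H)"
    using convex_closure_interior[OF H(1)] int closure_subset by (auto simp: H_def)
  have "\<exists>p'\<in>interior H. rot d \<bullet> p' < rot d \<bullet> v"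
  proof -
    have "open {z. rot d \<bullet> z < rot d \<bullet> v}" "p \<in> {z. rot d \<bullet> z < rot d \<bullet> v} \<inter> closure (interior H)"
      using pq H dense by (auto simp: open_halfspace_lt)
    then have "{z. rot d \<bullet> z < rot d \<bullet> v} \<inter> interior H \<noteq> {}"
      by (metis empty_iff open_Int_closure_eq_empty)
    then show ?thesis by blast
  qed
  then obtain p' where p': "p' \<in> interior H" "rot d \<bullet> p' < rot d \<bullet> v" by blast
  have "\<exists>q'\<in>interior H. rot d \<bullet> v < rot d \<bullet> q'"
  proof -
    have "open {z. rot d \<bullet> z > rot d \<bullet> v}" "q \<in> {z. rot d \<bullet> z > rot d \<bullet> v} \<inter> closure (interior H)"
      using pq H dense by (auto simp: open_halfspace_gt)
    then have "{z. rot d \<bullet> z > rot d \<bullet> v} \<inter> interior H \<noteq> {}"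
      by (metis empty_iff open_Int_closure_eq_empty)
    then show ?thesis by blast
  qed
  then obtain q' where q': "q' \<in> interior H" "rot d \<bullet> v < rot d \<bullet> q'" by blast
  define u where "u = (rot d \<bullet> v - rot d \<bullet> p') / (rot d \<bullet> q' - rot d \<bullet> p')"
  have u: "0 < u" "u < 1" "u * (rot d \<bullet> q' - rot d \<bullet> p') = rot d \<bullet> v - rot d \<bullet> p'"
    using p' q' by (auto simp: u_def field_simps)
  define w where "w = (1 - u) *\<^sub>R p' + u *\<^sub>R q'"
  have w: "w \<in> interior H"
    using u p' q' convex_interior[OF H(1)] unfolding w_def by (intro convexD) auto
  have "rot d \<bullet> (w - v) = 0"
    using u(3) by (simp add: w_def inner_add_right inner_diff_right algebra_simps)
  then obtain t where "w - v = t *\<^sub>R d"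
    using rot_parallel d by blast
  then have wt: "w = v + t *\<^sub>R d"
    by (simp add: algebra_simps)
  have "t \<noteq> 0"
    using w vi wt by auto
  have wH: "v + t *\<^sub>R d \<in> H"
    using w wt interior_subset by auto
  have "enters d H v (sgn t)"
    using \<open>t \<noteq> 0\<close> wH unfolding enters_def
    by (auto simp: sgn_if intro!: exI[of _ "\<bar>t\<bar>"])
  moreover have "r = sgn t" if r: "enters d H v r" for r
  proof (rule ccontr)
    assume ne: "r \<noteq> sgn t"
    obtain \<epsilon> where \<epsilon>: "\<epsilon> > 0" "v + (\<epsilon> * r) *\<^sub>R d \<in> H" and "r \<in> {1, -1}"
      using r by (auto simp: enters_def)
    then have "v \<in> open_segment (v + t *\<^sub>R d) (v + (\<epsilon> * r) *\<^sub>R d)"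
      using ne \<open>t \<noteq> 0\<close> d by (intro open_segment_opposite) auto
    moreover have "open_segment w (v + (\<epsilon> * r) *\<^sub>R d) \<subseteq> interior H"
      using w \<epsilon>(2) closure_subset by (intro in_interior_closure_convex_segment[OF H(1)]) auto
    ultimately show False
      using vi wt by auto
  qed
  ultimately have "{s. enters d H v s} = {sgn t}"
    by blast
  then show ?thesis
    by (simp add: H_def)
qed

text \<open>The 2 accounts for the lowest and the highest point, which start no ray; placed on the
  left, it avoids truncated subtraction.\<close>

lemma card_triangulation:
  assumes tri: "triangulates \<T> C" and fin: "finite C" and int: "interior (convex hull C) \<noteq> {}"
  shows "card \<T> + 2 = 2 * int_pts C + bd_pts C"
proof -
  obtain d where d: "d \<noteq> 0" and inj: "inj_on (\<lambda>z. rot d \<bullet> z) C"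
    using exists_generic_direction[OF fin] by blast
  define G where "G v = card {s. enters d (convex hull C) v s}" for v
  have finG: "finite {s. enters d (convex hull C) v s}" for v
    by (rule finite_subset[of _ "{1, -1}"]) (auto simp: enters_def)
  have ne: "C \<noteq> {}"
    using int by auto
  obtain lo where lo: "lo \<in> C" "\<And>z. z \<in> C \<Longrightarrow> rot d \<bullet> lo \<le> rot d \<bullet> z"
    using exists_lex_minimum[OF fin ne, of "\<lambda>z. rot d \<bullet> z"] by blast
  obtain hi where hi: "hi \<in> C" "\<And>z. z \<in> C \<Longrightarrow> rot d \<bullet> z \<le> rot d \<bullet> hi"
    using exists_lex_minimum[OF fin ne, of "\<lambda>z. - (rot d \<bullet> z)" "\<lambda>_. 0"] by auto
  have lo': "rot d \<bullet> lo < rot d \<bullet> z" if "z \<in> C" "z \<noteq> lo" for z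
    using lo that inj by (metis inj_onD order_le_less)
  have hi': "rot d \<bullet> z < rot d \<bullet> hi" if "z \<in> C" "z \<noteq> hi" for z
    using hi that inj by (metis inj_onD order_le_less)
  have "lo \<noteq> hi"
    using not_in_line[OF int d, of "rot d \<bullet> lo"] lo' hi' by force
  have Glo: "G lo = 0" and Ghi: "G hi = 0"
    using enters_extremal[OF d, of 1 C lo] enters_extremal[OF d, of "-1" C hi] lo' hi'
    by (auto simp: G_def)
  define I where "I = C \<inter> interior (convex hull C)"
  define F where "F = C \<inter> frontier (convex hull C)"
  have GI: "G v = 2" if "v \<in> I" for v
    using that enters_interior[OF _ d] by (auto simp: G_def I_def)
  have "closed (convex hull C)"
    using fin by (simp add: finite_imp_compact_convex_hull compact_imp_closed)
  then have C: "C = I \<union> F" "I \<inter> F = {}"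
    using hull_inc[of _ C convex] by (auto simp: frontier_def I_def F_def)
  have finIF: "finite I" "finite F"
    using fin by (auto simp: I_def F_def)
  \<comment> \<open>An interior point starts two rays, these two start none.\<close>
  have lohi: "{lo, hi} \<subseteq> F"
    using C lo(1) hi(1) GI Glo Ghi by force
  have GF: "G v = 1" if "v \<in> F - {lo, hi}" for v
    using that lo(1) hi(1) lo' hi' enters_frontier[OF int d, of v lo hi] by (auto simp: G_def F_def)
  have "card \<T> = (\<Sum>v\<in>C. G v)"
    using card_triangulation_eq_enters[OF tri fin d inj] fin finG by (simp add: G_def)
  also have "\<dots> = (\<Sum>v\<in>I. G v) + (\<Sum>v\<in>F. G v)"
    using C finIF by (metis sum.union_disjoint)
  also have "(\<Sum>v\<in>F. G v) = (\<Sum>v\<in>F - {lo, hi}. G v) + (\<Sum>v\<in>{lo, hi}. G v)"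
    by (rule sum.subset_diff[OF lohi finIF(2)])
  finally have "card \<T> = 2 * card I + card (F - {lo, hi})"
    using GI GF Glo Ghi \<open>lo \<noteq> hi\<close> by simp
  moreover have "card (F - {lo, hi}) + 2 = card F"
    using lohi finIF \<open>lo \<noteq> hi\<close> card_mono[OF finIF(2) lohi] by (simp add: card_Diff_subset)
  ultimately show ?thesis
    by (simp add: int_pts_def bd_pts_def I_def F_def)
qed

section \<open>The inequality for two sets with one interior point each\<close>

theorem theorem4p1:
  fixes A B :: "(real^2) set"
  assumes "finite A" and "finite B"
    and "\<not> collinear A" and "\<not> collinear B"
    and "int_pts A = 1" and "int_pts B = 1"
  shows "sqrt (2 * real (int_pts (A + B)) + real (bd_pts (A + B)) - 2)
           \<ge> sqrt (2 * real (int_pts A) + real (bd_pts A) - 2)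
             + sqrt (2 * real (int_pts B) + real (bd_pts B) - 2)
       \<and> (\<forall>\<T>\<^sub>A \<T>\<^sub>B \<T>.
            triangulates \<T>\<^sub>A A \<and> triangulates \<T>\<^sub>B B \<and> triangulates \<T> (A + B) \<longrightarrow>
            sqrt (real (card \<T>)) \<ge> sqrt (real (card \<T>\<^sub>A)) + sqrt (real (card \<T>\<^sub>B)))"
proof -
  have intA: "interior (convex hull A) \<inter> A \<noteq> {}" and intB: "interior (convex hull B) \<inter> B \<noteq> {}"
    using assms(5,6) by (auto simp: int_pts_def Int_commute dest!: card_1_singleton_iff[THEN iffD1])
  then have intAB: "interior (convex hull (A + B)) \<noteq> {}"
    using interior_convex_hull_plus by blast
  have tr: "real (card \<T>) = 2 * real (int_pts C) + real (bd_pts C) - 2"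
    if "triangulates \<T> C" "finite C" "interior (convex hull C) \<noteq> {}" for \<T> C
    using card_triangulation[OF that] by linarith
  \<comment> \<open>With a single interior point, \<open>2 * i + b - 2\<close> reduces to the number
    of boundary points.\<close>
  define a b where "a = real (bd_pts A)" and "b = real (bd_pts B)"
  have "card B \<le> int_pts (A + B)"
    using int_pts_plus[OF assms(2,1) intA] by (simp add: add.commute)
  then have "a + 1 \<le> int_pts (A + B)" "b + 1 \<le> int_pts (A + B)"
    using int_pts_plus[OF assms(1,2) intB] card_eq_int_pts_bd_pts[OF assms(1)]
      card_eq_int_pts_bd_pts[OF assms(2)] assms(5,6) by (auto simp: a_def b_def)
  moreover have "a + b \<le> bd_pts (A + B)"
    using bd_pts_plus[OF assms(1,2)] intA intB unfolding a_def b_def of_nat_add[symmetric] of_nat_le_iff by blast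
  moreover have "sqrt a * sqrt b \<le> (a + b) / 2"
    using arith_geo_mean_sqrt[of a b] by (simp add: a_def b_def real_sqrt_mult)
  moreover have "(sqrt a + sqrt b)\<^sup>2 = a + b + 2 * (sqrt a * sqrt b)"
    by (simp add: power2_sum a_def b_def)
  \<comment> \<open>The two bounds on the interior points add up to
    \<open>2 * i \<ge> a + b + 2\<close>, so the right side is at least \<open>2 * (a + b)\<close>;
    the mean inequality does the rest.\<close>
  ultimately have "(sqrt a + sqrt b)\<^sup>2 \<le> 2 * real (int_pts (A + B)) + real (bd_pts (A + B)) - 2"
    by argo
  then have main: "sqrt (2 * real (int_pts (A + B)) + real (bd_pts (A + B)) - 2)
      \<ge> sqrt (2 * real (int_pts A) + real (bd_pts A) - 2) + sqrt (2 * real (int_pts B) + real (bd_pts B) - 2)"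
    using assms(5,6) by (simp add: real_le_rsqrt a_def b_def)
  moreover have "sqrt (real (card \<T>)) \<ge> sqrt (real (card \<T>\<^sub>A)) + sqrt (real (card \<T>\<^sub>B))"
    if "triangulates \<T>\<^sub>A A" "triangulates \<T>\<^sub>B B" "triangulates \<T> (A + B)" for \<T>\<^sub>A \<T>\<^sub>B \<T>
  proof -
    have "interior (convex hull A) \<noteq> {}" "interior (convex hull B) \<noteq> {}"
      using intA intB by auto
    then show ?thesis
      using main tr[OF that(1) assms(1)] tr[OF that(2) assms(2)]
        tr[OF that(3) finite_set_plus[OF assms(1,2)] intAB] by simp
  qed
  ultimately show ?thesis by blast
qed

end
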